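(* Let $e_1,e_2,e_3$ be the generators of the Clifford algebra $A(Si)$ and let $\langle\cdot\rangle$ be a mean value on it. Let $\alpha,\beta,\gamma,a,b,c\in\mathbb{R}$ and put $$k=\alpha e_1+\beta e_2+\gamma e_3,\qquad L=a e_1+b e_2+c e_3 .$$ Let $A$ and $B$ be elements of the algebra with real mean values $\langle A\rangle,\langle B\rangle$ such that $A=k+\langle A\rangle$ and $B=L+\langle B\rangle$. Then $$\big\langle (A-\langle A\rangle)^2\big\rangle\,\big\langle (B-\langle B\rangle)^2\big\rangle\;\ge\;\Big|\tfrac12\langle AB-BA\rangle\Big|^2 .$$
   Context: $A(Si)$ is the associative unital complex algebra with basis $1,e_1,e_2,e_3$ and relations $e_1^2=e_2^2=e_3^2=1$, $e_1e_2=-e_2e_1=ie_3$, $e_2e_3=-e_3e_2=ie_1$, $e_3e_1=-e_1e_3=ie_2$, where $i=e_1e_2e_3$ is identified with the imaginary unit (equivalently, the algebra of $2\times2$ complex matrices with $e_j$ the Pauli matrices). A mean value $\langle\cdot\rangle$ is a complex-linear functional on $A(Si)$ with $\langle 1\rangle=1$ and $\langle e_j\rangle\in\mathbb{R}$, such that for all real $x_1,x_2,x_3$ $$-\sqrt{x_1^2+x_2^2+x_3^2}\;\le\; x_1\langle e_1\rangle+x_2\langle e_2\rangle+x_3\langle e_3\rangle\;\le\;\sqrt{x_1^2+x_2^2+x_3^2}$$ (the mean value of $x=\sum_j x_je_j$ lies between its two possible values $\pm\sqrt{x_1^2+x_2^2+x_3^2}$). Real and complex numbers are identified with multiples of $1$.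 *)

theory Defs
  imports Complex_Main
begin

locale complex_algebra = vector_space scale
  for scale :: "complex \<Rightarrow> 'a::ring_1 \<Rightarrow> 'a"  (infixr \<open>*\<^sub>\<complex>\<close> 75) +
  assumes mult_scale_left: "(z *\<^sub>\<complex> x) * y = z *\<^sub>\<complex> (x * y)"
    and mult_scale_right: "x * (z *\<^sub>\<complex> y) = z *\<^sub>\<complex> (x * y)"

text \<open>The algebra \<open>A(Si)\<close>, presented by its basis and multiplication table, and hence
  determined up to isomorphism. Independence of a set ignores repetitions, so
  distinctness of the basis elements is required separately.\<close>

locale clifford_Si = complex_algebra scale
  for scale :: "complex \<Rightarrow> 'a::ring_1 \<Rightarrow> 'a"  (infixr \<open>*\<^sub>\<complex>\<close> 75) +
  fixes e1 e2 e3 :: 'a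
  assumes basis_distinct: "distinct [1, e1, e2, e3]"
    and basis_independent: "independent {1, e1, e2, e3}"
    and basis_span: "span {1, e1, e2, e3} = UNIV"
    and e1_square: "e1\<^sup>2 = 1"
    and e2_square: "e2\<^sup>2 = 1"
    and e3_square: "e3\<^sup>2 = 1"
    and e1_e2: "e1 * e2 = \<i> *\<^sub>\<complex> e3"
    and e2_e1: "- (e2 * e1) = \<i> *\<^sub>\<complex> e3"
    and e2_e3: "e2 * e3 = \<i> *\<^sub>\<complex> e1"
    and e3_e2: "- (e3 * e2) = \<i> *\<^sub>\<complex> e1"
    and e3_e1: "e3 * e1 = \<i> *\<^sub>\<complex> e2"
    and e1_e3: "- (e1 * e3) = \<i> *\<^sub>\<complex> e2"
    and imaginary_unit: "e1 * e2 * e3 = \<i> *\<^sub>\<complex> 1"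

locale clifford_Si_mean = clifford_Si scale e1 e2 e3
  for scale :: "complex \<Rightarrow> 'a::ring_1 \<Rightarrow> 'a"  (infixr \<open>*\<^sub>\<complex>\<close> 75) and e1 e2 e3 :: 'a +
  fixes mean :: "'a \<Rightarrow> complex"
  assumes mean_linear: "Vector_Spaces.linear scale (*) mean"
    and mean_one: "mean 1 = 1"
    and mean_e1_real: "mean e1 \<in> \<real>"
    and mean_e2_real: "mean e2 \<in> \<real>"
    and mean_e3_real: "mean e3 \<in> \<real>"
    and mean_lower:
      "- sqrt (x1\<^sup>2 + x2\<^sup>2 + x3\<^sup>2) \<le> x1 * Re (mean e1) + x2 * Re (mean e2) + x3 * Re (mean e3)"
    and mean_upper:
      "x1 * Re (mean e1) + x2 * Re (mean e2) + x3 * Re (mean e3) \<le> sqrt (x1\<^sup>2 + x2\<^sup>2 + x3\<^sup>2)"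

end

theory Submission
  imports Defs
begin

text \<open>Centring \<open>A\<close> and \<open>B\<close> leaves the vectors \<open>k\<close> and \<open>L\<close>, and
  \<open>k * L = k \<cdot> L + \<i> (k \<times> L)\<close>. Hence the variances are \<open>|k|\<^sup>2\<close> and \<open>|L|\<^sup>2\<close>, while half the
  commutator has mean \<open>\<i> \<langle>k \<times> L\<rangle>\<close>, of modulus at most \<open>|k \<times> L| \<le> |k| |L|\<close>.\<close>

text \<open>Dropping the squared dot product on the right leaves |k \<times> L| \<le> |k| |L|, the
  only inequality needed besides the bounds on the mean.\<close>

lemma Lagrange_identity_3:
  fixes a1 a2 a3 b1 b2 b3 :: "'a::comm_ring_1"
  shows "(a1\<^sup>2 + a2\<^sup>2 + a3\<^sup>2) * (b1\<^sup>2 + b2\<^sup>2 + b3\<^sup>2) =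
    (a1 * b1 + a2 * b2 + a3 * b3)\<^sup>2 +
    ((a2 * b3 - a3 * b2)\<^sup>2 + (a3 * b1 - a1 * b3)\<^sup>2 + (a1 * b2 - a2 * b1)\<^sup>2)"
  by (simp add: power2_eq_square algebra_simps)

context clifford_Si
begin

text \<open>Complex coefficients keep the algebraic identities free of coercions; real vectors enter
  through \<open>of_real\<close>.\<close>

definition vec :: "complex \<Rightarrow> complex \<Rightarrow> complex \<Rightarrow> 'a"
  where "vec x y z = x *\<^sub>\<complex> e1 + y *\<^sub>\<complex> e2 + z *\<^sub>\<complex> e3"

text \<open>The squares of the generators give the dot product; by anticommutation the mixed
  products pair up into \<i> times the cross product.\<close>

lemma vec_mult_vec:
  "vec x y z * vec u v w = (x * u + y * v + z * w) *\<^sub>\<complex> 1 +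
    \<i> *\<^sub>\<complex> vec (y * w - z * v) (z * u - x * w) (x * v - y * u)"
proof -
  have anti: "e2 * e1 = - (\<i> *\<^sub>\<complex> e3)" "e3 * e2 = - (\<i> *\<^sub>\<complex> e1)" "e1 * e3 = - (\<i> *\<^sub>\<complex> e2)"
    by (simp_all flip: e2_e1 e3_e2 e1_e3)
  have sq: "e1 * e1 = 1" "e2 * e2 = 1" "e3 * e3 = 1"
    using e1_square e2_square e3_square by (simp_all add: power2_eq_square)
  show ?thesis
    unfolding vec_def
    by (simp add: distrib_left distrib_right mult_scale_left mult_scale_right anti sq
        e1_e2 e2_e3 e3_e1 scale_left_distrib scale_right_distrib scale_left_diff_distrib
        scale_right_diff_distrib algebra_simps)
qed

text \<open>The cross product of a vector with itself vanishes.\<close>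

lemma vec_square: "(vec x y z)\<^sup>2 = (x\<^sup>2 + y\<^sup>2 + z\<^sup>2) *\<^sub>\<complex> 1"
  unfolding power2_eq_square vec_mult_vec by (simp add: vec_def mult.commute)

text \<open>Swapping the factors preserves the dot product, which cancels, and negates the cross
  product, which doubles.\<close>

lemma vec_commutator:
  "vec x y z * vec u v w - vec u v w * vec x y z =
    (2 * \<i>) *\<^sub>\<complex> vec (y * w - z * v) (z * u - x * w) (x * v - y * u)"
proof -
  have "vec (v * z - w * y) (w * x - u * z) (u * y - v * x) =
      - vec (y * w - z * v) (z * u - x * w) (x * v - y * u)"
    by (simp add: vec_def scale_left_diff_distrib mult.commute)
  moreover have "(2 * \<i>) *\<^sub>\<complex> r = \<i> *\<^sub>\<complex> r + \<i> *\<^sub>\<complex> r" for r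
    by (simp flip: scale_left_distrib)
  ultimately show ?thesis
    unfolding vec_mult_vec by (simp add: mult.commute)
qed

text \<open>Multiples of 1 are central, so centring does not change a commutator.\<close>

lemma commutator_add_scalars:
  "(x + p *\<^sub>\<complex> 1) * (y + q *\<^sub>\<complex> 1) - (y + q *\<^sub>\<complex> 1) * (x + p *\<^sub>\<complex> 1) = x * y - y * x"
  by (simp add: distrib_left distrib_right mult_scale_left mult_scale_right
      scale_right_distrib mult.commute[of p q] add_ac)

end

context clifford_Si_mean
begin

lemma mean_scale: "mean (r *\<^sub>\<complex> x) = r * mean x"
  and mean_add: "mean (x + y) = mean x + mean y"
  using mean_linear by (simp_all add: Vector_Spaces.linear_iff)

lemma mean_vec_square: "mean ((vec x y z)\<^sup>2) = x\<^sup>2 + y\<^sup>2 + z\<^sup>2"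
  by (simp add: vec_square mean_scale mean_one)

text \<open>With real coefficients the mean is real, so the lower and upper bounds on mean values
  together bound its modulus.\<close>

lemma cmod_mean_vec_le:
  "cmod (mean (vec (of_real x) (of_real y) (of_real z))) \<le> sqrt (x\<^sup>2 + y\<^sup>2 + z\<^sup>2)"
proof -
  have real: "mean e = of_real (Re (mean e))" if "mean e \<in> \<real>" for e
    using that by simp
  have "mean (vec (of_real x) (of_real y) (of_real z)) =
      of_real (x * Re (mean e1) + y * Re (mean e2) + z * Re (mean e3))"
    using real[OF mean_e1_real] real[OF mean_e2_real] real[OF mean_e3_real]
    by (simp add: vec_def mean_add mean_scale)
  then show ?thesis
    using mean_lower[of x y z] mean_upper[of x y z] by (simp only: norm_of_real abs_le_iff minus_le_iff simp_thms)
qed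

lemma mean_vec_uncertainty:
  "(cmod (1 / 2 * mean (vec (of_real x) (of_real y) (of_real z) * vec (of_real u) (of_real v) (of_real w)
      - vec (of_real u) (of_real v) (of_real w) * vec (of_real x) (of_real y) (of_real z))))\<^sup>2
    \<le> (x\<^sup>2 + y\<^sup>2 + z\<^sup>2) * (u\<^sup>2 + v\<^sup>2 + w\<^sup>2)"
    (is "(cmod (1 / 2 * mean ?C))\<^sup>2 \<le> _")
proof -
  let ?p = "y * w - z * v" and ?q = "z * u - x * w" and ?r = "x * v - y * u"
  \<comment> \<open>The commutator is 2\<i> times the cross product: 1/2 cancels the 2, and \<i> has
    modulus 1.\<close>
  have "cmod (1 / 2 * mean ?C) = cmod (mean (vec (of_real ?p) (of_real ?q) (of_real ?r)))"
    by (simp add: vec_commutator mean_scale norm_mult)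
  also have "\<dots> \<le> sqrt (?p\<^sup>2 + ?q\<^sup>2 + ?r\<^sup>2)"
    by (rule cmod_mean_vec_le)
  finally have "(cmod (1 / 2 * mean ?C))\<^sup>2 \<le> ?p\<^sup>2 + ?q\<^sup>2 + ?r\<^sup>2"
    using power_mono[of _ "sqrt (?p\<^sup>2 + ?q\<^sup>2 + ?r\<^sup>2)" 2] by fastforce
  also have "\<dots> \<le> (x\<^sup>2 + y\<^sup>2 + z\<^sup>2) * (u\<^sup>2 + v\<^sup>2 + w\<^sup>2)"
    by (simp add: Lagrange_identity_3)
  finally show ?thesis .
qed

end

theorem mainTheorem3:
  fixes scale :: "complex \<Rightarrow> 'a::ring_1 \<Rightarrow> 'a"
    and e1 e2 e3 k L A B :: 'a
    and mean :: "'a \<Rightarrow> complex"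
    and \<alpha> \<beta> \<gamma> a b c :: real
  assumes "clifford_Si_mean scale e1 e2 e3 mean"
    and "k = scale (of_real \<alpha>) e1 + scale (of_real \<beta>) e2 + scale (of_real \<gamma>) e3"
    and "L = scale (of_real a) e1 + scale (of_real b) e2 + scale (of_real c) e3"
    and "mean A \<in> \<real>"
    and "mean B \<in> \<real>"
    and "A = k + scale (mean A) 1"
    and "B = L + scale (mean B) 1"
  shows "mean ((A - scale (mean A) 1)\<^sup>2) \<in> \<real> \<and>
    mean ((B - scale (mean B) 1)\<^sup>2) \<in> \<real> \<and>
    Re (mean ((A - scale (mean A) 1)\<^sup>2)) * Re (mean ((B - scale (mean B) 1)\<^sup>2))
      \<ge> (cmod (1 / 2 * mean (A * B - B * A)))\<^sup>2"
proof -
  interpret clifford_Si_mean scale e1 e2 e3 mean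
    by (rule assms(1))
  have k: "k = vec (of_real \<alpha>) (of_real \<beta>) (of_real \<gamma>)"
    and L: "L = vec (of_real a) (of_real b) (of_real c)"
    by (simp_all add: vec_def assms(2,3))
  have centred: "A - scale (mean A) 1 = k" "B - scale (mean B) 1 = L"
    using assms(6,7) by (simp_all add: diff_eq_eq)
  \<comment> \<open>The form \<open>of_real\<close> of a real sum of squares yields both reality
    claims and the values of \<open>Re\<close>.\<close>
  have var: "mean (k\<^sup>2) = of_real (\<alpha>\<^sup>2 + \<beta>\<^sup>2 + \<gamma>\<^sup>2)" "mean (L\<^sup>2) = of_real (a\<^sup>2 + b\<^sup>2 + c\<^sup>2)"
    by (simp_all add: k L mean_vec_square)
  have comm: "A * B - B * A = k * L - L * k"
    using commutator_add_scalars[of k "mean A" L "mean B"] assms(6,7) by simp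
  show ?thesis
    unfolding centred comm var Re_complex_of_real
    using mean_vec_uncertainty[of \<alpha> \<beta> \<gamma> a b c] by (simp only: k L Reals_of_real simp_thms)
qed

end
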